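(* Let $d \ge 1$, let $G = (V,E)$ be a connected, undirected graph with $V = \{1,\dots,N\}$ and $E \subset \{(n,m) \in V \times V : n < m\}$, let $\boldsymbol{y} = (\boldsymbol{y}_n)_{n \in V} \in (\mathbb{R}^d)^N$, and let $\lambda > 0$. Let $\boldsymbol{x}^* \in \mathbb{C}_d^N$ be a solution of the convexified TV problem $$\operatorname*{arg\,min}_{\boldsymbol{x} \in \mathbb{R}^{d \times N}} \; \mathcal{K}(\boldsymbol{x}) \quad \text{s.t.} \quad \boldsymbol{x}_n \in \mathbb{C}_d \ \text{ for all } n \in V.$$ Then, for (Lebesgue-)almost all $\boldsymbol{\eta} \in \mathbb{C}_d$, the signal $X_{\boldsymbol{\eta}}(\boldsymbol{x}^* ) \in \mathbb{B}_d^N$ is a solution of the non-convex problem $$\operatorname*{arg\,min}_{\boldsymbol{x} \in \mathbb{B}_d^N} \; \frac{1}{2} \sum_{n \in V} \|\boldsymbol{x}_n - \boldsymbol{y}_n\|_2^2 + \lambda \operatorname{TV}(\boldsymbol{x}).$$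
   Context: Notation: $\mathbb{B}_d = \{-1,1\}^d \subset \mathbb{R}^d$ and $\mathbb{C}_d = \operatorname{conv}(\mathbb{B}_d) = [-1,1]^d$. A signal is $\boldsymbol{x} = (\boldsymbol{x}_n)_{n \in V}$ with $\boldsymbol{x}_n = (\boldsymbol{x}_{n,1},\dots,\boldsymbol{x}_{n,d}) \in \mathbb{R}^d$. The anisotropic total variation is $\operatorname{TV}(\boldsymbol{x}) = \sum_{(n,m) \in E} \|\boldsymbol{x}_n - \boldsymbol{x}_m\|_1$, and the objective of the convexified problem is $$\mathcal{K}(\boldsymbol{x}) = -\sum_{n \in V} \langle \boldsymbol{x}_n, \boldsymbol{y}_n \rangle + \lambda \operatorname{TV}(\boldsymbol{x}),$$ where $\langle\cdot,\cdot\rangle$ is the Euclidean inner product on $\mathbb{R}^d$. For $\boldsymbol{\eta} = (\boldsymbol{\eta}_1,\dots,\boldsymbol{\eta}_d) \in \mathbb{C}_d$, the thresholding map $X_{\boldsymbol{\eta}} : \mathbb{R}^d \to \mathbb{B}_d$ is defined by $X_{\boldsymbol{\eta}}(\boldsymbol{x}_n) = (\chi_{\boldsymbol{\eta}_i}(\boldsymbol{x}_{n,i}))_{i=1}^d$, where $\chi_{\boldsymbol{\eta}_i}(t) = 1$ if $t > \boldsymbol{\eta}_i$ and $\chi_{\boldsymbol{\eta}_i}(t) = -1$ if $t \le \boldsymbol{\eta}_i$. It is extended to entire signals, with the same $\boldsymbol{\eta}$ at every vertex, by $X_{\boldsymbol{\eta}}(\boldsymbol{x}) = (X_{\boldsymbol{\eta}}(\boldsymbol{x}_n))_{n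 \in V}$. "Solution" means global minimizer. *)

theory Defs
  imports "HOL-Analysis.Analysis" "Graph_Theory.Digraph_Component"
begin

(* Signals on the vertex set {1..N} are elements of {1..N} \<rightarrow>\<^sub>E S with S a set of vectors,
   i.e. functions on nat that are undefined outside {1..N}; this is the N-fold product of S. *)

definition sign_cube :: "(real ^ 'd) set" where
  "sign_cube = {x. \<forall>i. x $ i \<in> {-1, 1}}"

definition solid_cube :: "(real ^ 'd) set" where
  "solid_cube = convex hull sign_cube"

(* An undirected graph given by oriented edges (n, m) with n < m, each edge listed once.
   Connectivity of a digraph in the library is that of its symmetric closure, and it includes
   nonemptiness of the vertex set, hence N \<ge> 1. *)
definition connected_graph :: "nat \<Rightarrow> (nat \<times> nat) set \<Rightarrow> bool" where
  "connected_graph N E \<longleftrightarrow>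
     E \<subseteq> {(n, m). n \<in> {1..N} \<and> m \<in> {1..N} \<and> n < m} \<and>
     Digraph_Component.connected (with_proj \<lparr>pverts = {1..N}, parcs = E\<rparr>)"

(* norm on real ^ 'd is the Euclidean norm *)
definition l1_norm :: "real ^ 'd \<Rightarrow> real" where
  "l1_norm v = (\<Sum>i\<in>UNIV. \<bar>v $ i\<bar>)"

definition TV :: "(nat \<times> nat) set \<Rightarrow> (nat \<Rightarrow> real ^ 'd) \<Rightarrow> real" where
  "TV E x = (\<Sum>(n, m)\<in>E. l1_norm (x n - x m))"

definition convexified_objective ::
  "nat \<Rightarrow> (nat \<times> nat) set \<Rightarrow> real \<Rightarrow> (nat \<Rightarrow> real ^ 'd) \<Rightarrow> (nat \<Rightarrow> real ^ 'd) \<Rightarrow> real" where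
  "convexified_objective N E lam y x = - (\<Sum>n\<in>{1..N}. x n \<bullet> y n) + lam * TV E x"

definition nonconvex_objective ::
  "nat \<Rightarrow> (nat \<times> nat) set \<Rightarrow> real \<Rightarrow> (nat \<Rightarrow> real ^ 'd) \<Rightarrow> (nat \<Rightarrow> real ^ 'd) \<Rightarrow> real" where
  "nonconvex_objective N E lam y x =
     1 / 2 * (\<Sum>n\<in>{1..N}. (norm (x n - y n))\<^sup>2) + lam * TV E x"

definition threshold :: "real \<Rightarrow> real \<Rightarrow> real" where
  "threshold s t = (if t > s then 1 else -1)"

definition threshold_vec :: "real ^ 'd \<Rightarrow> real ^ 'd \<Rightarrow> real ^ 'd" where
  "threshold_vec \<eta> v = (\<chi> i. threshold (\<eta> $ i) (v $ i))"

definition threshold_signal ::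
  "nat \<Rightarrow> real ^ 'd \<Rightarrow> (nat \<Rightarrow> real ^ 'd) \<Rightarrow> (nat \<Rightarrow> real ^ 'd)" where
  "threshold_signal N \<eta> x = (\<lambda>n\<in>{1..N}. threshold_vec \<eta> (x n))"

end

theory Submission
  imports Defs
begin

text \<open>If the threshold satisfies \<open>\<eta>\<^sub>i < 1\<close> for all \<open>i\<close>, a small multiple of the thresholded signal can
  be split off from the solution: \<open>x\<^sup>* = p X + (1 - p) v\<close>, where \<open>X\<close> is the thresholded signal,
  \<open>0 < p < 1\<close> and \<open>v\<close> is still feasible. Along every edge, \<open>X\<close> and \<open>v\<close> vary in the same
  direction, so the total variation, and with it the convexified objective, is affine on this segment.
  Optimality of \<open>x\<^sup>*\<close> then forces \<open>X\<close> to be optimal as well, and on the sign cube the two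
  objectives differ by a constant. The exceptional \<open>\<eta>\<close> lie on finitely many hyperplanes.\<close>

text \<open>Convex hulls commute with affine maps, so the known description of the unit cube as the
  hull of the 0-1 vectors is transported along \<open>f\<close>, which carries [0,1] onto [-1,1] in
  every coordinate.\<close>

lemma solid_cube_eq: "solid_cube = {x :: real ^ 'd. \<forall>i. -1 \<le> x $ i \<and> x $ i \<le> 1}"
proof -
  define f where "f = (\<lambda>x :: real ^ 'd. (\<chi> i. -1) + 2 *\<^sub>R x)"
  \<comment> \<open>The explicit inverse of \<open>f\<close> supplies the witness for both
    surjectivity arguments below.\<close>
  have preimage: "z = f ((1 / 2) *\<^sub>R (z + (\<chi> i. 1)))" for z :: "real ^ 'd"
    by (simp add: f_def vec_eq_iff)
  have sign: "sign_cube = f ` {x. \<forall>i. x $ i = 0 \<or> x $ i = 1}"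
  proof
    show "f ` {x. \<forall>i. x $ i = 0 \<or> x $ i = 1} \<subseteq> sign_cube"
      by (force simp: f_def sign_cube_def)
    show "sign_cube \<subseteq> f ` {x. \<forall>i. x $ i = 0 \<or> x $ i = 1}"
      by (intro subsetI image_eqI[where f = f, OF preimage]) (force simp: sign_cube_def f_def)
  qed
  have unit: "convex hull {x :: real ^ 'd. \<forall>i. x $ i = 0 \<or> x $ i = 1} = cbox 0 1"
    unfolding Cart_1 unit_interval_convex_hull
    by (simp add: Basis_vec_def inner_axis)
  have hull: "convex hull (f ` S) = f ` (convex hull S)" for S
    unfolding f_def by (rule convex_hull_affinity)
  have "solid_cube = convex hull (f ` {x. \<forall>i. x $ i = 0 \<or> x $ i = 1})"
    unfolding solid_cube_def sign ..
  also have "\<dots> = f ` cbox 0 1"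
    unfolding hull unit ..
  also have "\<dots> = {x. \<forall>i. -1 \<le> x $ i \<and> x $ i \<le> 1}"
  proof
    show "f ` cbox 0 1 \<subseteq> {x. \<forall>i. -1 \<le> x $ i \<and> x $ i \<le> 1}"
      by (auto simp: f_def mem_box_cart)
    show "{x. \<forall>i. -1 \<le> x $ i \<and> x $ i \<le> 1} \<subseteq> f ` cbox 0 1"
    proof (intro subsetI image_eqI[where f = f, OF preimage])
      fix z :: "real ^ 'd" assume z: "z \<in> {x. \<forall>i. -1 \<le> x $ i \<and> x $ i \<le> 1}"
      have "-1 \<le> z $ i" "z $ i \<le> 1" for i
        using z by auto
      then show "(1 / 2) *\<^sub>R (z + (\<chi> i. 1)) \<in> cbox 0 1"
        by (auto simp: mem_box_cart) (smt (verit))+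
    qed
  qed
  finally show ?thesis .
qed

lemma sign_cube_subset_solid_cube: "sign_cube \<subseteq> solid_cube"
  unfolding solid_cube_def by (rule hull_subset)

lemma threshold_signal_in_sign_cube: "threshold_signal N \<eta> x \<in> {1..N} \<rightarrow>\<^sub>E sign_cube"
  by (auto simp: threshold_signal_def threshold_vec_def threshold_def sign_cube_def)

lemma abs_lincomb_same_sign:
  fixes a b p q :: real
  assumes "0 \<le> a * b" "0 \<le> p" "0 \<le> q"
  shows "\<bar>p * a + q * b\<bar> = p * \<bar>a\<bar> + q * \<bar>b\<bar>"
proof (cases "0 \<le> a \<and> 0 \<le> b")
  case True
  then show ?thesis using assms by simp
next
  case False
  then have "a \<le> 0 \<and> b \<le> 0"
    using assms(1) by (auto simp: zero_le_mult_iff)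
  moreover from this have "p * a \<le> 0" "q * b \<le> 0"
    using assms by (simp_all add: mult_nonneg_nonpos)
  ultimately show ?thesis by simp
qed

text \<open>The triangle inequality in each TV term is an equality when the differences of
  \<open>u\<close> and \<open>v\<close> along an edge never have opposite signs in a coordinate; the
  data term is linear.\<close>

lemma convexified_objective_comonotone:
  fixes u v x y :: "nat \<Rightarrow> real ^ 'd"
  assumes E: "E \<subseteq> {1..N} \<times> {1..N}"
    and pq: "0 \<le> p" "0 \<le> q"
    and x: "\<And>n. n \<in> {1..N} \<Longrightarrow> x n = p *\<^sub>R u n + q *\<^sub>R v n"
    and sign: "\<And>n m i. (n, m) \<in> E \<Longrightarrow> 0 \<le> (u n $ i - u m $ i) * (v n $ i - v m $ i)"
  shows "convexified_objective N E lam y x =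
    p * convexified_objective N E lam y u + q * convexified_objective N E lam y v"
proof -
  have edge: "l1_norm (x n - x m) = p * l1_norm (u n - u m) + q * l1_norm (v n - v m)"
    if "(n, m) \<in> E" for n m
  proof -
    have "n \<in> {1..N}" "m \<in> {1..N}" using that E by auto
    then have "x n - x m = p *\<^sub>R (u n - u m) + q *\<^sub>R (v n - v m)"
      by (simp add: x algebra_simps)
    then show ?thesis
      by (simp add: l1_norm_def abs_lincomb_same_sign[OF sign[OF that] pq]
          sum.distrib sum_distrib_left)
  qed
  have "TV E x = (\<Sum>(n, m)\<in>E. p * l1_norm (u n - u m) + q * l1_norm (v n - v m))"
    unfolding TV_def by (rule sum.cong) (auto simp: edge)
  then have tv: "TV E x = p * TV E u + q * TV E v"
    by (simp add: TV_def case_prod_unfold sum.distrib sum_distrib_left)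
  have "(\<Sum>n\<in>{1..N}. x n \<bullet> y n) = (\<Sum>n\<in>{1..N}. p * (u n \<bullet> y n) + q * (v n \<bullet> y n))"
    by (rule sum.cong) (simp_all add: x inner_add_left)
  then show ?thesis
    by (simp add: convexified_objective_def tv sum.distrib sum_distrib_left[symmetric] algebra_simps)
qed

text \<open>All points of the sign cube have squared norm \<open>CARD('d)\<close>, so expanding the
  square leaves only the linear term and a constant independent of \<open>z\<close>.\<close>

lemma nonconvex_objective_sign_cube:
  fixes z y :: "nat \<Rightarrow> real ^ 'd"
  assumes "z \<in> {1..N} \<rightarrow>\<^sub>E sign_cube"
  shows "nonconvex_objective N E lam y z = convexified_objective N E lam y z
    + (\<Sum>n\<in>{1..N}. (real CARD('d) + y n \<bullet> y n) / 2)"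
proof -
  have sq: "(norm (z n - y n))\<^sup>2 / 2 = - (z n \<bullet> y n) + (real CARD('d) + y n \<bullet> y n) / 2"
    if "n \<in> {1..N}" for n
  proof -
    have "z n \<in> sign_cube" using assms that by auto
    then have "z n $ i = -1 \<or> z n $ i = 1" for i
      by (auto simp: sign_cube_def)
    then have "z n $ i * z n $ i = 1" for i
      by (metis mult_1 mult_minus_left minus_minus)
    then have "z n \<bullet> z n = real CARD('d)"
      by (simp add: inner_vec_def)
    then show ?thesis
      by (simp add: power2_norm_eq_inner inner_diff inner_commute field_simps)
  qed
  have "1 / 2 * (\<Sum>n\<in>{1..N}. (norm (z n - y n))\<^sup>2) = (\<Sum>n\<in>{1..N}. (norm (z n - y n))\<^sup>2 / 2)"
    by (simp add: sum_divide_distrib)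
  also have "\<dots> = (\<Sum>n\<in>{1..N}. - (z n \<bullet> y n) + (real CARD('d) + y n \<bullet> y n) / 2)"
    by (rule sum.cong) (simp_all only: sq)
  finally show ?thesis
    by (simp only: nonconvex_objective_def convexified_objective_def sum.distrib sum_negf)
qed

text \<open>Finitely many positive numbers have a positive minimum. The two bounds are what keeps
  the remainder of the splitting inside the cube; the second also preserves the order along
  edges.\<close>

lemma threshold_gap:
  fixes x :: "nat \<Rightarrow> real ^ 'd" and \<eta> :: "real ^ 'd"
  assumes "\<And>i. \<eta> $ i < 1"
  obtains p where "0 < p" "p < 1"
    and "\<And>i. 2 * p \<le> 1 - \<eta> $ i"
    and "\<And>n i. n \<in> {1..N} \<Longrightarrow> \<eta> $ i < x n $ i \<Longrightarrow> 2 * p \<le> x n $ i - \<eta> $ i"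
proof -
  \<comment> \<open>The element 1 makes \<open>Min S\<close> at most 1, so that half of it is below
    1.\<close>
  define S where "S = insert 1 (range (\<lambda>i. 1 - \<eta> $ i) \<union>
    (\<lambda>(n, i). x n $ i - \<eta> $ i) ` {(n, i) \<in> {1..N} \<times> UNIV. \<eta> $ i < x n $ i})"
  have fin: "finite S"
    unfolding S_def by (intro finite.insertI finite_UnI finite_imageI)
      (auto intro: finite_subset[of _ "{1..N} \<times> UNIV"])
  have le: "Min S \<le> s" if "s \<in> S" for s
    using fin that by simp
  have "Min S \<in> S"
    using fin by (intro Min_in) (auto simp: S_def)
  then have pos: "0 < Min S"
    using assms by (auto simp: S_def)
  show ?thesis
  proof (rule that[of "Min S / 2"])
    show "Min S / 2 < 1"
      using le[of 1] by (simp add: S_def)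
    show "2 * (Min S / 2) \<le> 1 - \<eta> $ i" for i
      using le[of "1 - \<eta> $ i"] by (simp add: S_def)
    show "2 * (Min S / 2) \<le> x n $ i - \<eta> $ i" if "n \<in> {1..N}" "\<eta> $ i < x n $ i" for n i
    proof -
      have "x n $ i - \<eta> $ i \<in> S"
        using that by (force simp: S_def)
      then show ?thesis using le by simp
    qed
  qed (use pos in simp)
qed

text \<open>The bounds on \<open>\<eta>\<close> are asymmetric like the threshold: coordinates
  strictly above it have a positive gap of their own, but those at or below it may equal it, and
  their distance to 1 is controlled only by \<open>1 - \<eta> $ i\<close>.\<close>

lemma convexified_objective_threshold_le:
  fixes x y :: "nat \<Rightarrow> real ^ 'd"
  assumes E: "E \<subseteq> {1..N} \<times> {1..N}"
    and sol: "is_arg_min (convexified_objective N E lam y) (\<lambda>x. x \<in> {1..N} \<rightarrow>\<^sub>E solid_cube) x"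
    and \<eta>: "\<And>i. -1 \<le> \<eta> $ i" "\<And>i. \<eta> $ i < 1"
  shows "convexified_objective N E lam y (threshold_signal N \<eta> x) \<le> convexified_objective N E lam y x"
proof -
  let ?K = "convexified_objective N E lam y"
  obtain p where p: "0 < p" "p < 1" "\<And>i. 2 * p \<le> 1 - \<eta> $ i"
    and gap: "\<And>n i. n \<in> {1..N} \<Longrightarrow> \<eta> $ i < x n $ i \<Longrightarrow> 2 * p \<le> x n $ i - \<eta> $ i"
    using threshold_gap[of \<eta> N x] \<eta>(2) by metis
  define u where "u = threshold_signal N \<eta> x"
  \<comment> \<open>Obtained by solving \<open>x n = p *\<^sub>R u n + (1 - p) *\<^sub>R v n\<close>
    for \<open>v n\<close>.\<close>
  define v where "v = (\<lambda>n\<in>{1..N}. (1 / (1 - p)) *\<^sub>R (x n - p *\<^sub>R u n))"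
  have u: "u n $ i = (if \<eta> $ i < x n $ i then 1 else -1)" if "n \<in> {1..N}" for n i
    using that by (simp add: u_def threshold_signal_def threshold_vec_def threshold_def)
  have v: "v n $ i = (x n $ i - p * u n $ i) / (1 - p)" if "n \<in> {1..N}" for n i
    using that by (simp add: v_def)
  have xbd: "-1 \<le> x n $ i" "x n $ i \<le> 1" if "n \<in> {1..N}" for n i
  proof -
    have "x n \<in> solid_cube" using sol that by (auto simp: is_arg_min_def)
    then show "-1 \<le> x n $ i" "x n $ i \<le> 1" by (auto simp: solid_cube_eq)
  qed
  have "v n \<in> solid_cube" if n: "n \<in> {1..N}" for n
  proof -
    have "-1 \<le> v n $ i \<and> v n $ i \<le> 1" for i
    proof -
      \<comment> \<open>If \<open>u n $ i = 1\<close>, the lower bound follows from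
        \<open>x n $ i \<ge> \<eta> $ i + 2 * p \<ge> -1 + 2 * p\<close>; if it is -1, the upper
        bound follows from \<open>x n $ i \<le> \<eta> $ i \<le> 1 - 2 * p\<close>. The other bounds
        are those of the cube.\<close>
      have "- (1 - p) \<le> x n $ i - p * u n $ i" "x n $ i - p * u n $ i \<le> 1 - p"
        using xbd[OF n, of i] gap[OF n, of i] \<eta>(1)[of i] p(3)[of i] p(1)
        by (auto simp: u[OF n] split: if_splits)
      then show ?thesis
        using p(2) by (simp add: v[OF n] pos_le_divide_eq pos_divide_le_eq algebra_simps)
    qed
    then show ?thesis by (simp add: solid_cube_eq)
  qed
  then have "v \<in> {1..N} \<rightarrow>\<^sub>E solid_cube"
    by (auto simp: v_def)
  then have Kv: "?K x \<le> ?K v"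
    using sol by (auto simp: is_arg_min_def not_less)
  have "0 \<le> (u n $ i - u m $ i) * (v n $ i - v m $ i)" if "(n, m) \<in> E" for n m i
  proof -
    have nm: "n \<in> {1..N}" "m \<in> {1..N}" using that E by auto
    have "v n $ i - v m $ i = (x n $ i - x m $ i - p * (u n $ i - u m $ i)) / (1 - p)"
      by (simp add: v[OF nm(1)] v[OF nm(2)] diff_divide_distrib right_diff_distrib)
    \<comment> \<open>Only edges across the threshold matter: there the values of \<open>u\<close>
      differ by 2, and the gap makes those of \<open>x\<close> differ by at least
      \<open>2 * p\<close> in the same direction.\<close>
    moreover have "0 \<le> (u n $ i - u m $ i) * (x n $ i - x m $ i - p * (u n $ i - u m $ i))"
      using gap[OF nm(1), of i] gap[OF nm(2), of i] by (auto simp: u[OF nm(1)] u[OF nm(2)])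
    ultimately show ?thesis using p(2) by simp
  qed
  moreover have "x n = p *\<^sub>R u n + (1 - p) *\<^sub>R v n" if "n \<in> {1..N}" for n
    using that p(2) by (simp add: v_def)
  ultimately have "?K x = p * ?K u + (1 - p) * ?K v"
    using p by (intro convexified_objective_comonotone[OF E]) simp_all
  moreover have "(1 - p) * ?K x \<le> (1 - p) * ?K v"
    using Kv p by simp
  ultimately have "p * ?K u \<le> p * ?K x"
    by (simp add: algebra_simps)
  then show ?thesis using p(1) by (simp add: u_def)
qed

theorem theorem2:
  fixes N :: nat and E :: "(nat \<times> nat) set"
    and y xstar :: "nat \<Rightarrow> real ^ 'd" and lam :: real
  assumes graph: "connected_graph N E"
    and y: "y \<in> {1..N} \<rightarrow>\<^sub>E UNIV"
    and lam: "lam > 0"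
    and sol: "is_arg_min (convexified_objective N E lam y)
                (\<lambda>x. x \<in> {1..N} \<rightarrow>\<^sub>E solid_cube) xstar"
  shows "AE \<eta>\<in>solid_cube in lebesgue.
           is_arg_min (nonconvex_objective N E lam y)
             (\<lambda>x. x \<in> {1..N} \<rightarrow>\<^sub>E sign_cube) (threshold_signal N \<eta> xstar)"
proof -
  let ?K = "convexified_objective N E lam y"
  have E: "E \<subseteq> {1..N} \<times> {1..N}"
    using graph by (auto simp: connected_graph_def)
  have "is_arg_min (nonconvex_objective N E lam y)
      (\<lambda>x. x \<in> {1..N} \<rightarrow>\<^sub>E sign_cube) (threshold_signal N \<eta> xstar)"
    if \<eta>: "\<eta> \<in> solid_cube" "\<And>i. \<eta> $ i \<noteq> 1" for \<eta>
  proof -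
    let ?X = "threshold_signal N \<eta> xstar"
    have X: "?K ?X \<le> ?K xstar"
      using \<eta> by (intro convexified_objective_threshold_le[OF E sol])
        (auto simp: solid_cube_eq less_le)
    have "nonconvex_objective N E lam y ?X \<le> nonconvex_objective N E lam y z"
      if z: "z \<in> {1..N} \<rightarrow>\<^sub>E sign_cube" for z
    proof -
      \<comment> \<open>Binary signals are feasible for the convexified problem, so its minimum
        bounds their objective from below.\<close>
      have "z \<in> {1..N} \<rightarrow>\<^sub>E solid_cube"
        using z sign_cube_subset_solid_cube by (auto simp: PiE_iff)
      then have "?K xstar \<le> ?K z"
        using sol by (auto simp: is_arg_min_def not_less)
      then show ?thesis
        using X by (simp only: nonconvex_objective_sign_cube[OF z]
            nonconvex_objective_sign_cube[OF threshold_signal_in_sign_cube])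
    qed
    then show ?thesis
      unfolding is_arg_min_def
      by (intro conjI notI threshold_signal_in_sign_cube) (meson not_less)
  qed
  moreover have "AE \<eta> :: real ^ 'd in lebesgue. \<forall>i. \<eta> $ i \<noteq> 1"
  proof -
    \<comment> \<open>Written as inner products with basis vectors, the exceptional conditions
      define one hyperplane per coordinate, each a null set.\<close>
    have "negligible (\<Union>i. {\<eta> :: real ^ 'd. \<eta> $ i = 1})"
      unfolding cart_eq_inner_axis
      by (intro negligible_Union) auto
    then show ?thesis
      by (intro AE_I'[of "\<Union>i. {\<eta> :: real ^ 'd. \<eta> $ i = 1}"])
        (auto simp: negligible_iff_null_sets)
  qed
  ultimately show ?thesis by auto
qed

end
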